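(* Let $B\ge 1$, let $x_{\rm tr}\in\mathbb{C}^B\setminus\{0\}$ be a fixed training vector, let $\sigma_x^2,\sigma_w^2>0$, let $a,b>0$ be the constants associated with the digital modulation used, and let $h\in\mathbb{C}$ be the given true channel coefficient of the flat-fading AWGN channel. Then the MVU filter $f_{\rm MVU}=x_{\rm tr}/\|x_{\rm tr}\|^2$ is not an optimal channel estimator for the task of minimizing the zeroth order error probability $[P_e]_0$ given $h$; that is, $f_{\rm MVU}$ does not minimize $f\mapsto[P_e]_0(f;h)$ over $f\in\mathbb{C}^B\setminus\{0\}$.
   Context: A linear channel estimator is determined by a filter $f\in\mathbb{C}^B$ through $\hat h=f^Hy_{\rm tr}$, where $y_{\rm tr}=h\,x_{\rm tr}+w_{\rm tr}$ and $w_{\rm tr}\in\mathbb{C}^B$ has i.i.d. circularly symmetric complex Gaussian entries of mean $0$ and variance $\sigma_w^2$; data symbols have mean zero and power $\sigma_x^2$. For common modulations, the error probability in an AWGN channel is approximately $aQ(b\sqrt{\mathrm{SNR}})$, where $a,b>0$ depend on the constellation geometry and $Q(x)=\frac{1}{\sqrt{2\pi}}\int_x^{\infty}e^{-t^2/2}\,dt$. The zeroth order error probability is defined as $$[P_e]_0(f;h)=a\,Q\!\left(b\sqrt{\frac{|h|^2|f^Hx_{\rm tr}|^2+\sigma_w^2\|f\|^2}{\sigma_w^2/\sigma_x^2+|h|^2|f^Hx_{\rm tr}-1|^2+\sigma_w^2\|f\|^2}}\right).$$ *)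

theory Defs
  imports "HOL-Analysis.Analysis"
begin

definition Qfun :: "real \<Rightarrow> real" where
  "Qfun x = 1 / sqrt (2 * pi) * (LINT t:{x..}|lborel. exp (- t\<^sup>2 / 2))"

(* f^H x: conjugate-linear in the first argument. The inner product that the library
   provides on complex ^ 'n is only its real part. *)
definition herm_prod :: "complex ^ 'n \<Rightarrow> complex ^ 'n \<Rightarrow> complex" where
  "herm_prod f x = (\<Sum>i\<in>UNIV. cnj (f $ i) * x $ i)"

(* sigma_x and sigma_w are standard deviations, so the powers are their squares. *)
definition SNR0 ::
  "real \<Rightarrow> real \<Rightarrow> complex ^ 'n \<Rightarrow> complex ^ 'n \<Rightarrow> complex \<Rightarrow> real" where
  "SNR0 sigma_x sigma_w x_tr f h =
     ((cmod h)\<^sup>2 * (cmod (herm_prod f x_tr))\<^sup>2 + sigma_w\<^sup>2 * (norm f)\<^sup>2) /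
     (sigma_w\<^sup>2 / sigma_x\<^sup>2 + (cmod h)\<^sup>2 * (cmod (herm_prod f x_tr - 1))\<^sup>2
        + sigma_w\<^sup>2 * (norm f)\<^sup>2)"

definition Pe0 ::
  "real \<Rightarrow> real \<Rightarrow> real \<Rightarrow> real \<Rightarrow> complex ^ 'n \<Rightarrow> complex ^ 'n \<Rightarrow> complex \<Rightarrow> real" where
  "Pe0 a b sigma_x sigma_w x_tr f h = a * Qfun (b * sqrt (SNR0 sigma_x sigma_w x_tr f h))"

definition f_MVU :: "complex ^ 'n \<Rightarrow> complex ^ 'n" where
  "f_MVU x_tr = x_tr /\<^sub>R (norm x_tr)\<^sup>2"

end

theory Submission
  imports Defs "HOL-Probability.Distributions"
begin

text \<open>Rescaling the MVU filter by a real factor \<open>t\<close> gives, with \<open>c = \<sigma>\<^sub>w\<^sup>2 / \<parallel>x\<^sub>t\<^sub>r\<parallel>\<^sup>2\<close>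
  and \<open>d = \<sigma>\<^sub>w\<^sup>2 / \<sigma>\<^sub>x\<^sup>2\<close>, the signal-to-noise ratio
  \<open>t\<^sup>2 (|h|\<^sup>2 + c) / (d + |h|\<^sup>2 (t - 1)\<^sup>2 + c t\<^sup>2)\<close>. For \<open>t > 1\<close> it exceeds its value at \<open>t = 1\<close>
  if and only if \<open>|h|\<^sup>2 (t - 1) < d (t + 1)\<close>, which holds for \<open>t\<close> slightly above \<open>1\<close>.
  Since \<open>Q\<close> is strictly decreasing, such a rescaled filter has a smaller error probability.\<close>

text \<open>Up to the factor \<open>sqrt (2 * pi)\<close> this is the standard normal
  density.\<close>

lemma integrable_exp_neg_half_square:
  "integrable lborel (\<lambda>t::real. exp (- t\<^sup>2 / 2))"
proof -
  have "integrable lborel (\<lambda>t. sqrt (2 * pi) * normal_density 0 1 t)"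
    by (intro integrable_mult_right integrable_normal_density) simp
  moreover have "(\<lambda>t. sqrt (2 * pi) * normal_density 0 1 t) = (\<lambda>t. exp (- t\<^sup>2 / 2))"
    by (simp add: normal_density_def fun_eq_iff)
  ultimately show ?thesis
    by metis
qed

text \<open>The two tail integrals differ by the integral of a nonnegative function that is positive
  exactly on \<open>{x..<y}\<close>. Were that integral zero, this interval of length
  \<open>y - x\<close> would be a null set.\<close>

lemma Qfun_strict_antimono:
  assumes "x < y"
  shows "Qfun y < Qfun x"
proof -
  let ?g = "\<lambda>t::real. exp (- t\<^sup>2 / 2)"
  let ?G = "\<lambda>u t. indicator {u..} t *\<^sub>R ?g t"
  have int: "integrable lborel (?G u)" for u :: real
    by (rule integrable_mult_indicator[OF _ integrable_exp_neg_half_square]) simp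
  have nonneg: "?G x t - ?G y t \<ge> 0" for t
    using assms by (simp add: indicator_def)
  have "(LINT t|lborel. ?G x t - ?G y t) \<noteq> 0"
  proof
    assume "(LINT t|lborel. ?G x t - ?G y t) = 0"
    then have "AE t in lborel. ?G x t - ?G y t = 0"
      using integral_nonneg_eq_0_iff_AE[of lborel "\<lambda>t. ?G x t - ?G y t"] int nonneg by auto
    then have "AE t in lborel. t \<notin> {x..<y}"
      by eventually_elim (auto simp: indicator_def)
    then have "emeasure lborel {x..<y} = 0"
      by (subst (asm) AE_iff_measurable[where N = "{x..<y}"]) auto
    then show False
      using assms by simp
  qed
  moreover have "(LINT t|lborel. ?G x t - ?G y t) \<ge> 0"
    using nonneg by (rule Bochner_Integration.integral_nonneg)
  ultimately have "(LINT t|lborel. ?G y t) < (LINT t|lborel. ?G x t)"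
    by (simp only: Bochner_Integration.integral_diff[OF int int])
  then show ?thesis
    by (simp add: Qfun_def set_lebesgue_integral_def divide_strict_right_mono)
qed

lemma herm_prod_scaleR_left: "herm_prod (r *\<^sub>R f) x = of_real r * herm_prod f x"
  unfolding herm_prod_def sum_distrib_left
  by (intro sum.cong) (simp_all add: scaleR_conv_of_real[symmetric])

lemma herm_prod_self: "herm_prod x x = of_real ((norm x)\<^sup>2)"
  by (simp add: herm_prod_def norm_vec_def L2_set_def sum_nonneg mult.commute complex_norm_square
    flip: of_real_power)

lemma SNR0_scaleR_f_MVU:
  assumes "x_tr \<noteq> 0"
  shows "SNR0 sigma_x sigma_w x_tr (t *\<^sub>R f_MVU x_tr) h =
    t\<^sup>2 * ((cmod h)\<^sup>2 + sigma_w\<^sup>2 / (norm x_tr)\<^sup>2) /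
    (sigma_w\<^sup>2 / sigma_x\<^sup>2 + (cmod h)\<^sup>2 * (t - 1)\<^sup>2 + t\<^sup>2 * (sigma_w\<^sup>2 / (norm x_tr)\<^sup>2))"
proof -
  have hp: "herm_prod (t *\<^sub>R f_MVU x_tr) x_tr = of_real t"
    using assms by (simp add: f_MVU_def herm_prod_scaleR_left herm_prod_self)
  have nrm: "(norm (t *\<^sub>R f_MVU x_tr))\<^sup>2 = t\<^sup>2 / (norm x_tr)\<^sup>2"
    using assms by (simp add: f_MVU_def power_mult_distrib power_divide field_simps power2_eq_square)
  have "cmod (of_real t - 1) = \<bar>t - 1\<bar>"
    by (metis norm_of_real of_real_1 of_real_diff)
  then show ?thesis
    unfolding SNR0_def hp nrm by (simp add: distrib_left mult.commute)
qed

theorem proposition5: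
  fixes x_tr :: "complex ^ 'n" and h :: complex
    and a b sigma_x sigma_w :: real
  assumes "x_tr \<noteq> 0"
    and "sigma_x\<^sup>2 > 0" and "sigma_w\<^sup>2 > 0"
    and "a > 0" and "b > 0"
  shows "\<not> is_arg_min (\<lambda>f. Pe0 a b sigma_x sigma_w x_tr f h) (\<lambda>f. f \<noteq> 0) (f_MVU x_tr)"
proof -
  define H where "H = (cmod h)\<^sup>2"
  define c where "c = sigma_w\<^sup>2 / (norm x_tr)\<^sup>2"
  define d where "d = sigma_w\<^sup>2 / sigma_x\<^sup>2"
  \<comment> \<open>This choice gives \<open>H * u = d - u < d\<close>, stronger than the required
    \<open>H * u < d * (u + 2)\<close>. The summand 1 keeps the denominator positive even for
    \<open>h = 0\<close>.\<close>
  define u where "u = d / (H + 1)"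
  define t where "t = 1 + u"
  let ?S = "\<lambda>f. SNR0 sigma_x sigma_w x_tr f h"
  have pos: "H \<ge> 0" "c > 0" "d > 0"
    using assms by (simp_all add: H_def c_def d_def)
  have "u > 0"
    using pos by (simp add: u_def)
  have "u * (H + 1) = d"
    using pos by (simp add: u_def)
  then have "H * u < d"
    using \<open>u > 0\<close> by (simp add: algebra_simps)
  \<comment> \<open>Since \<open>u = t - 1\<close>, the two sides are
    \<open>H * (t - 1)\<^sup>2\<close> and \<open>d * (t\<^sup>2 - 1)\<close>; adding
    \<open>d + t\<^sup>2 * c\<close> to both yields the next inequality.\<close>
  then have "u * (H * u) < u * (d * (t + 1))"
    using \<open>u > 0\<close> pos by (intro mult_strict_left_mono) (simp_all add: t_def add_strict_increasing algebra_simps)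
  then have num: "d + H * (t - 1)\<^sup>2 + t\<^sup>2 * c < t\<^sup>2 * (d + c)"
    by (simp add: t_def algebra_simps power2_eq_square)
  have S: "?S (s *\<^sub>R f_MVU x_tr) = s\<^sup>2 * (H + c) / (d + H * (s - 1)\<^sup>2 + s\<^sup>2 * c)" for s
    using SNR0_scaleR_f_MVU[OF assms(1)] by (simp add: H_def c_def d_def)
  have den: "0 < d + H * (t - 1)\<^sup>2 + t\<^sup>2 * c"
    using pos by (intro add_pos_nonneg) auto
  \<comment> \<open>This is the comparison of the ratios at \<open>s = 1\<close> and
    \<open>s = t\<close>, cross-multiplied; at \<open>s = 1\<close> the ratio is
    \<open>(H + c) / (d + c)\<close>.\<close>
  have "(H + c) * (d + H * (t - 1)\<^sup>2 + t\<^sup>2 * c) < (H + c) * (t\<^sup>2 * (d + c))"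
    using pos by (intro mult_strict_left_mono[OF num]) simp
  then have "(H + c) / (d + c) < t\<^sup>2 * (H + c) / (d + H * (t - 1)\<^sup>2 + t\<^sup>2 * c)"
    using pos den by (simp add: divide_less_eq less_divide_eq mult.commute mult.left_commute)
  then have "?S (f_MVU x_tr) < ?S (t *\<^sub>R f_MVU x_tr)"
    using S[of 1] S[of t] by simp
  then have "Qfun (b * sqrt (?S (t *\<^sub>R f_MVU x_tr))) < Qfun (b * sqrt (?S (f_MVU x_tr)))"
    using assms by (intro Qfun_strict_antimono) simp
  then have "Pe0 a b sigma_x sigma_w x_tr (t *\<^sub>R f_MVU x_tr) h < Pe0 a b sigma_x sigma_w x_tr (f_MVU x_tr) h"
    using assms by (simp add: Pe0_def)
  moreover have "t *\<^sub>R f_MVU x_tr \<noteq> 0"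
    using assms \<open>u > 0\<close> by (simp add: t_def f_MVU_def)
  ultimately show ?thesis
    unfolding is_arg_min_def by blast
qed

end
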